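(* Let $\Sigma$ be an $n\times n$ real symmetric positive-definite matrix, $X$ an $n\times p$ real matrix of full column rank, and $$M=\Sigma^{-1}-\Sigma^{-1}X(X^{*}\Sigma^{-1}X)^{-1}X^{*}\Sigma^{-1}.$$ Let $y=(y_1,\dots,y_n)\in\mathbb R^n$ have the (possibly improper) density $p(y)\propto\exp(-\tfrac12\,y^{*}My)$, so that $M$ is its precision matrix. Let $i\neq j$. If $M_{ij}=0$, then $y_i$ and $y_j$ are conditionally independent given $\{y_k : k=1,\dots,n;\ k\ne i,j\}$.
   Context: $(\cdot)^{*}$ is the transpose. The function $p$ is the likelihood of a Gaussian process regression with covariance $\Sigma$ and design matrix $X$; it is constant along $\operatorname{im}(X)=\ker(M)$, hence in general an improper density on $\mathbb R^n$, i.e. a positive function defined up to a positive multiplicative constant. The precision matrix of $p$ is by definition $M$, which equals the Bott-Duffin inverse $\Sigma^{(-1)}_{(\mathcal X^\perp)}=P_{\mathcal X^\perp}(P_{\mathcal X}+\Sigma P_{\mathcal X^\perp})^{-1}$ of $\Sigma$, where $\mathcal X=\operatorname{im}(X)$ and $P_{\mathcal R}$ is the orthogonal projection matrix onto $\mathcal R$. Conditional independence of $y_i$ and $y_j$ given the remaining coordinates $y_{\setminus\{i,j\}}$ means that the conditional density factorizes, $p(y_i,y_j\mid y_{\setminus\{i,j\}})=p(y_i\mid y_{\setminus\{i,j\}})\,p(y_j\mid y_{\setminus\{i,j\}})$, where (since $p$ may be improper) the factors are densities up to positive factors not depending on $y_i,y_j$; that is, for each fixed value of $y_{\setminus\{i,j\}}$,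 $p(y)$ as a function of $(y_i,y_j)$ is a product of a positive function of $y_i$ alone and a positive function of $y_j$ alone. *)

theory Defs
  imports Complex_Main "Jordan_Normal_Form.DL_Rank" "Jordan_Normal_Form.Gauss_Jordan_Elimination"
begin

definition symmetric_mat :: "real mat \<Rightarrow> bool" where
  "symmetric_mat A \<longleftrightarrow> A\<^sup>T = A"

definition pos_def_mat :: "nat \<Rightarrow> real mat \<Rightarrow> bool" where
  "pos_def_mat n A \<longleftrightarrow> A \<in> carrier_mat n n \<and>
     (\<forall>x\<in>carrier_vec n. x \<noteq> 0\<^sub>v n \<longrightarrow> 0 < x \<bullet> (A *\<^sub>v x))"

(* mat_inverse yields Some B exactly for invertible A, with B the two-sided inverse; on a singular
   matrix inv_mat is unspecified. *)
definition inv_mat :: "real mat \<Rightarrow> real mat" where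
  "inv_mat A = the (mat_inverse A)"

definition precision_mat :: "real mat \<Rightarrow> real mat \<Rightarrow> real mat" where
  "precision_mat \<Sigma> X =
     inv_mat \<Sigma> - inv_mat \<Sigma> * X * inv_mat (X\<^sup>T * inv_mat \<Sigma> * X) * X\<^sup>T * inv_mat \<Sigma>"

(* A possibly improper density on R^n is a positive function on carrier_vec n, determined only up to
   a positive factor; it need not be integrable. *)
definition gaussian_density :: "nat \<Rightarrow> real mat \<Rightarrow> (real vec \<Rightarrow> real) \<Rightarrow> bool" where
  "gaussian_density n M f \<longleftrightarrow>
     (\<exists>c>0. \<forall>y\<in>carrier_vec n. f y = c * exp (- (1/2) * (y \<bullet> (M *\<^sub>v y))))"

(* Conditional independence of coordinates i and j given all the others, for a possibly improper
   density f. The vector z carries the conditioning values; its entries at i and j are overwritten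
   by s and t. The factors g and h may depend on z. *)
definition cond_indep :: "nat \<Rightarrow> (real vec \<Rightarrow> real) \<Rightarrow> nat \<Rightarrow> nat \<Rightarrow> bool" where
  "cond_indep n f i j \<longleftrightarrow>
     (\<forall>z\<in>carrier_vec n. \<exists>g h. (\<forall>s::real. 0 < g s) \<and> (\<forall>t::real. 0 < h t) \<and>
        (\<forall>s t. f (vec n (\<lambda>k. if k = i then s else if k = j then t else z $ k)) = g s * h t))"

end

(* Substituting y_i = s and y_j = t into y^* M y produces s and t jointly only in the cross term
   (M_ij + M_ji) s t. The matrix M is symmetric, because inverses of symmetric matrices are symmetric, so
   M_ij = 0 kills the cross term and the exponential splits into a function of s times a function
   of t. Positive definiteness and full column rank serve only to make the inverses exist. *)

theory Submission
  imports Defs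
begin

text \<open>A singular \<open>A\<close> would kill some nonzero \<open>v\<close>, giving
  \<open>v \<bullet> (A *\<^sub>v v) = 0\<close> against positive definiteness. Hence
  \<open>mat_inverse\<close> returns \<open>Some\<close> and the \<open>the\<close> in
  \<open>inv_mat\<close> is harmless.\<close>

lemma inv_mat_pos_def:
  assumes "pos_def_mat n A"
  shows "inv_mat A \<in> carrier_mat n n" "A * inv_mat A = 1\<^sub>m n" "inv_mat A * A = 1\<^sub>m n"
proof -
  have A: "A \<in> carrier_mat n n" using assms by (simp add: pos_def_mat_def)
  have "det A \<noteq> 0"
  proof
    assume "det A = 0"
    then obtain v where v: "v \<in> carrier_vec n" "v \<noteq> 0\<^sub>v n" "A *\<^sub>v v = 0\<^sub>v n"
      using det_0_iff_vec_prod_zero[OF A] by blast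
    then have "0 < v \<bullet> 0\<^sub>v n" using assms by (metis pos_def_mat_def)
    then show False using v(1) by simp
  qed
  then have "A \<in> Units (ring_mat TYPE(real) n ())"
    by (rule det_non_zero_imp_unit[OF A])
  then obtain B where "mat_inverse A = Some B"
    using mat_inverse(1)[OF A, where b = "()"] by (cases "mat_inverse A") auto
  then show "inv_mat A \<in> carrier_mat n n" "A * inv_mat A = 1\<^sub>m n" "inv_mat A * A = 1\<^sub>m n"
    using mat_inverse(2)[OF A] by (auto simp: inv_mat_def)
qed

text \<open>Transposing \<open>A * inv_mat A = 1\<^sub>m n\<close> makes the transposed inverse a
  left inverse of \<open>A\<close>, and a left inverse coincides with a right one.\<close>

lemma inv_mat_pos_def_symmetric:
  assumes "pos_def_mat n A" and "symmetric_mat A"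
  shows "symmetric_mat (inv_mat A)"
proof -
  let ?B = "inv_mat A"
  have A: "A \<in> carrier_mat n n" using assms by (simp add: pos_def_mat_def)
  note B = inv_mat_pos_def[OF assms(1)]
  have BT: "?B\<^sup>T \<in> carrier_mat n n" using B(1) by simp
  have "?B\<^sup>T * A = 1\<^sub>m n"
    using transpose_mult[OF A B(1)] B(2) assms(2) by (simp add: symmetric_mat_def)
  then have "?B = (?B\<^sup>T * A) * ?B" using B(1) by simp
  also have "\<dots> = ?B\<^sup>T * (A * ?B)" using BT A B(1) by (rule assoc_mult_mat)
  also have "\<dots> = ?B\<^sup>T" using B BT by simp
  finally show ?thesis by (simp add: symmetric_mat_def)
qed

text \<open>The substitution \<open>x = A *\<^sub>v u\<close> turns the form of the inverse at
  \<open>x\<close> into the form of \<open>A\<close> at \<open>u\<close>. Through congruence with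
  \<open>X\<close> this will make the inner matrix of \<open>precision_mat\<close>
  invertible.\<close>

lemma inv_mat_pos_def_pos_def:
  assumes "pos_def_mat n A"
  shows "pos_def_mat n (inv_mat A)"
  unfolding pos_def_mat_def
proof (intro conjI ballI impI)
  note B = inv_mat_pos_def[OF assms]
  have A: "A \<in> carrier_mat n n" using assms by (simp add: pos_def_mat_def)
  show "inv_mat A \<in> carrier_mat n n" by (rule B(1))
  fix x :: "real vec" assume x: "x \<in> carrier_vec n" "x \<noteq> 0\<^sub>v n"
  define u where "u = inv_mat A *\<^sub>v x"
  have u: "u \<in> carrier_vec n" using B(1) x by (simp add: u_def)
  have Au: "A *\<^sub>v u = x"
    using assoc_mult_mat_vec[OF A B(1) x(1)] B(2) x(1) by (simp add: u_def)
  have "u \<noteq> 0\<^sub>v n"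
  proof
    assume "u = 0\<^sub>v n"
    then have "x = 0\<^sub>v n" using Au A by auto
    with x(2) show False by simp
  qed
  then have "0 < u \<bullet> (A *\<^sub>v u)" using assms u by (simp add: pos_def_mat_def)
  also have "u \<bullet> (A *\<^sub>v u) = x \<bullet> u" using comm_scalar_prod[OF u x(1)] by (simp add: Au)
  finally show "0 < x \<bullet> (inv_mat A *\<^sub>v x)" by (simp add: u_def)
qed

text \<open>A nonzero kernel vector is a linear dependence among the columns. Independence is a
  property of the set of columns, which forgets repetitions, so the columns must first be shown
  distinct.\<close>

lemma (in vec_space) full_col_rank_kernel:
  assumes A: "A \<in> carrier_mat n nc" and rk: "rank A = nc"
    and v: "v \<in> carrier_vec nc" "A *\<^sub>v v = 0\<^sub>v n"
  shows "v = 0\<^sub>v nc"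
proof (rule ccontr)
  assume nz: "v \<noteq> 0\<^sub>v nc"
  have "distinct (cols A)"
  proof (rule ccontr)
    assume "\<not> distinct (cols A)"
    \<comment> \<open>A repetition leaves fewer than \<open>nc\<close> distinct columns, whereas the
      rank is the size of a maximal independent subset of them.\<close>
    then have less: "card (set (cols A)) < nc"
      using A card_distinct[of "cols A"] card_length[of "cols A"] by fastforce
    obtain S where S: "maximal S (\<lambda>T. T \<subseteq> set (cols A) \<and> lin_indpt T)"
      using maximal_exists[of "(\<lambda>T. T \<subseteq> set (cols A) \<and> lin_indpt T)" "card (set (cols A))" "{}"]
      by (meson List.finite_set card_mono empty_iff empty_subsetI finite_lin_indpt2 rev_finite_subset)
    then have "card S \<le> card (set (cols A))" by (simp add: card_mono maximal_def)
    with less rk rank_card_indpt[OF A S] show False by simp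
  qed
  then show False
    using lin_depI[OF A v(1) nz v(2)] full_rank_lin_indpt[OF A rk] by blast
qed

text \<open>Moving \<open>X\<^sup>T\<close> across the scalar product gives the form of
  \<open>B\<close> at \<open>X *\<^sub>v v\<close>, a nonzero vector because full column rank makes
  \<open>X\<close> injective.\<close>

lemma pos_def_mat_congruence:
  assumes B: "pos_def_mat n B" and X: "X \<in> carrier_mat n p" and rk: "vec_space.rank n X = p"
  shows "pos_def_mat p (X\<^sup>T * B * X)"
  unfolding pos_def_mat_def
proof (intro conjI ballI impI)
  have Bc: "B \<in> carrier_mat n n" using B by (simp add: pos_def_mat_def)
  have XT: "X\<^sup>T \<in> carrier_mat p n" using X by simp
  show "X\<^sup>T * B * X \<in> carrier_mat p p" using XT Bc X by simp
  fix v :: "real vec" assume v: "v \<in> carrier_vec p" "v \<noteq> 0\<^sub>v p"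
  have Xv: "X *\<^sub>v v \<in> carrier_vec n" using X v by simp
  have BXv: "B *\<^sub>v (X *\<^sub>v v) \<in> carrier_vec n" using Bc Xv by simp
  have "X *\<^sub>v v \<noteq> 0\<^sub>v n"
    using vec_space.full_col_rank_kernel[OF X rk v(1)] v(2) by blast
  then have "0 < (X *\<^sub>v v) \<bullet> (B *\<^sub>v (X *\<^sub>v v))"
    using B Xv by (simp add: pos_def_mat_def)
  also have "\<dots> = (B *\<^sub>v (X *\<^sub>v v)) \<bullet> (X *\<^sub>v v)"
    using Xv BXv by (rule comm_scalar_prod)
  also have "\<dots> = (X\<^sup>T *\<^sub>v (B *\<^sub>v (X *\<^sub>v v))) \<bullet> v"
    by (rule transpose_vec_mult_scalar[OF X v(1) BXv, symmetric])
  also have "\<dots> = v \<bullet> (X\<^sup>T *\<^sub>v (B *\<^sub>v (X *\<^sub>v v)))"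
    using mult_mat_vec_carrier[OF XT BXv] v(1) by (rule comm_scalar_prod)
  also have "X\<^sup>T *\<^sub>v (B *\<^sub>v (X *\<^sub>v v)) = X\<^sup>T * B * X *\<^sub>v v"
    using assoc_mult_mat_vec[OF XT Bc Xv] assoc_mult_mat_vec[OF mult_carrier_mat[OF XT Bc] X v(1)]
    by simp
  finally show "0 < v \<bullet> (X\<^sup>T * B * X *\<^sub>v v)" .
qed

lemma symmetric_mat_congruence:
  assumes B: "B \<in> carrier_mat n n" "symmetric_mat B" and X: "X \<in> carrier_mat n p"
  shows "symmetric_mat (X\<^sup>T * B * X)"
proof -
  have XT: "X\<^sup>T \<in> carrier_mat p n" using X by simp
  have "(X\<^sup>T * B * X)\<^sup>T = X\<^sup>T * (B\<^sup>T * X)"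
    using transpose_mult[OF mult_carrier_mat[OF XT B(1)] X] transpose_mult[OF XT B(1)] by simp
  also have "\<dots> = X\<^sup>T * B * X"
    using B assoc_mult_mat[OF XT B(1) X] by (simp add: symmetric_mat_def)
  finally show ?thesis by (simp add: symmetric_mat_def)
qed

lemma precision_mat_symmetric:
  assumes S: "symmetric_mat \<Sigma>" "pos_def_mat n \<Sigma>"
    and X: "X \<in> carrier_mat n p" and rk: "vec_space.rank n X = p"
  shows "precision_mat \<Sigma> X \<in> carrier_mat n n" "symmetric_mat (precision_mat \<Sigma> X)"
proof -
  define B where "B = inv_mat \<Sigma>"
  define C where "C = inv_mat (X\<^sup>T * B * X)"
  have XT: "X\<^sup>T \<in> carrier_mat p n" using X by simp
  have B: "B \<in> carrier_mat n n" "symmetric_mat B" "pos_def_mat n B"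
    using inv_mat_pos_def[OF S(2)] inv_mat_pos_def_symmetric[OF S(2,1)]
      inv_mat_pos_def_pos_def[OF S(2)] by (simp_all add: B_def)
  have pd: "pos_def_mat p (X\<^sup>T * B * X)" by (rule pos_def_mat_congruence[OF B(3) X rk])
  have C: "C \<in> carrier_mat p p" "symmetric_mat C"
    using inv_mat_pos_def(1)[OF pd]
      inv_mat_pos_def_symmetric[OF pd symmetric_mat_congruence[OF B(1,2) X]]
    by (simp_all add: C_def)
  \<comment> \<open>Since \<open>B\<close> is symmetric, the transpose of \<open>D\<close> is
    \<open>B * X\<close>. The subtracted term is therefore a congruence of the symmetric matrix
    \<open>C\<close>, hence symmetric itself.\<close>
  define D where "D = X\<^sup>T * B"
  have D: "D \<in> carrier_mat p n" using XT B by (simp add: D_def)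
  have DT: "D\<^sup>T = B * X"
    using transpose_mult[OF XT B(1)] B(2) by (simp add: D_def symmetric_mat_def)
  have BXC: "B * X * C \<in> carrier_mat n p" using B X C by simp
  have M: "precision_mat \<Sigma> X = B - D\<^sup>T * C * D"
    using assoc_mult_mat[OF BXC XT B(1)]
    by (simp add: precision_mat_def DT) (simp add: B_def C_def D_def)
  have DCD: "D\<^sup>T * C * D \<in> carrier_mat n n" using D C by simp
  show "precision_mat \<Sigma> X \<in> carrier_mat n n" using DCD by (simp add: M minus_carrier_mat)
  show "symmetric_mat (precision_mat \<Sigma> X)"
    using transpose_minus[OF B(1) DCD] B(2) symmetric_mat_congruence[OF C D]
    by (simp add: M symmetric_mat_def)
qed

text \<open>Without interaction between \<open>a\<close> and \<open>b\<close> the form separates: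
  each summand on the right involves at most one of them. \<open>M\<close> is not assumed symmetric,
  so the interaction must vanish in both orders.\<close>

lemma quadratic_form_split:
  fixes M :: "real mat"
  assumes M: "M \<in> carrier_mat n n"
    and w: "w \<in> carrier_vec n" and a: "a \<in> carrier_vec n" and b: "b \<in> carrier_vec n"
    and ab: "a \<bullet> (M *\<^sub>v b) = 0" and ba: "b \<bullet> (M *\<^sub>v a) = 0"
  shows "(w + a + b) \<bullet> (M *\<^sub>v (w + a + b)) =
    (w + a) \<bullet> (M *\<^sub>v (w + a)) + (w + b) \<bullet> (M *\<^sub>v (w + b)) - w \<bullet> (M *\<^sub>v w)"
proof -
  have add: "(x + y) \<bullet> (M *\<^sub>v (x + y)) =
      x \<bullet> (M *\<^sub>v x) + x \<bullet> (M *\<^sub>v y) + y \<bullet> (M *\<^sub>v x) + y \<bullet> (M *\<^sub>v y)"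
    if "x \<in> carrier_vec n" "y \<in> carrier_vec n" for x y
    using M that
    by (simp add: mult_add_distrib_mat_vec[OF M] add_scalar_prod_distrib[of _ n]
        scalar_prod_add_distrib[of _ n])
  \<comment> \<open>Adding \<open>b\<close> thus changes the form by the same amount at
    \<open>w + a\<close> as at \<open>w\<close>; comparing the two expansions gives the
    claim.\<close>
  have cross: "(w + a) \<bullet> (M *\<^sub>v b) = w \<bullet> (M *\<^sub>v b)" "b \<bullet> (M *\<^sub>v (w + a)) = b \<bullet> (M *\<^sub>v w)"
    using M w a b ab ba
    by (simp_all add: mult_add_distrib_mat_vec[OF M] add_scalar_prod_distrib[of _ n]
        scalar_prod_add_distrib[of _ n])
  show ?thesis
    using add[of "w + a" b] add[of w b] w a b cross by simp
qed

lemma smult_unit_vec_bilinear: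
  fixes M :: "real mat"
  assumes M: "M \<in> carrier_mat n n" and "i < n" "j < n"
  shows "(s \<cdot>\<^sub>v unit_vec n i) \<bullet> (M *\<^sub>v (t \<cdot>\<^sub>v unit_vec n j)) = s * t * M $$ (i, j)"
  using assms by (simp add: mult_mat_vec[OF M])

lemma gaussian_density_cond_indep:
  assumes M: "M \<in> carrier_mat n n" and f: "gaussian_density n M f"
    and ij: "i < n" "j < n" "i \<noteq> j"
    and zero: "M $$ (i, j) = 0" "M $$ (j, i) = 0"
  shows "cond_indep n f i j"
  unfolding cond_indep_def
proof
  fix z :: "real vec" assume z: "z \<in> carrier_vec n"
  obtain c where c: "c > 0"
    and fc: "\<And>y. y \<in> carrier_vec n \<Longrightarrow> f y = c * exp (- (1/2) * (y \<bullet> (M *\<^sub>v y)))"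
    using f by (auto simp: gaussian_density_def)
  define q where "q y = y \<bullet> (M *\<^sub>v y)" for y
  \<comment> \<open>Zeroing both coordinates makes the overwritten vector equal to \<open>w\<close>
    plus \<open>s\<close> and \<open>t\<close> multiples of two unit vectors.\<close>
  define w where "w = vec n (\<lambda>k. if k = i then 0 else if k = j then 0 else z $ k)"
  \<comment> \<open>The factors come from exponentiating the split form. The normalizing constant
    \<open>c\<close> is assigned to \<open>g\<close> and the correction \<open>q w\<close> to
    \<open>h\<close>; both depend only on \<open>z\<close>.\<close>
  define g where "g s = c * exp (- (1/2) * q (w + s \<cdot>\<^sub>v unit_vec n i))" for s
  define h where "h t = exp (- (1/2) * (q (w + t \<cdot>\<^sub>v unit_vec n j) - q w))" for t
  have w: "w \<in> carrier_vec n" by (simp add: w_def)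
  have "f (vec n (\<lambda>k. if k = i then s else if k = j then t else z $ k)) = g s * h t" for s t
  proof -
    let ?a = "s \<cdot>\<^sub>v unit_vec n i" and ?b = "t \<cdot>\<^sub>v unit_vec n j"
    have y: "vec n (\<lambda>k. if k = i then s else if k = j then t else z $ k) = w + ?a + ?b"
      using ij by (intro eq_vecI) (auto simp: w_def unit_vec_def)
    have "q (w + ?a + ?b) = q (w + ?a) + q (w + ?b) - q w"
      unfolding q_def
      by (rule quadratic_form_split[OF M w])
        (simp_all add: smult_unit_vec_bilinear[OF M] ij zero smult_carrier_vec)
    then have "f (w + ?a + ?b) = c * exp (- (1/2) * q (w + ?a) + - (1/2) * (q (w + ?b) - q w))"
      using fc[of "w + ?a + ?b"] w by (simp add: q_def[symmetric] algebra_simps)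
    then show ?thesis
      unfolding y g_def h_def by (simp only: exp_add mult.assoc)
  qed
  moreover have "0 < g s" "0 < h s" for s using c by (simp_all add: g_def h_def)
  ultimately show "\<exists>g h. (\<forall>s::real. 0 < g s) \<and> (\<forall>t::real. 0 < h t) \<and>
      (\<forall>s t. f (vec n (\<lambda>k. if k = i then s else if k = j then t else z $ k)) = g s * h t)"
    by blast
qed

theorem mainTheorem8:
  fixes n p i j :: nat and \<Sigma> X M :: "real mat" and f :: "real vec \<Rightarrow> real"
  assumes "\<Sigma> \<in> carrier_mat n n" and "symmetric_mat \<Sigma>" and "pos_def_mat n \<Sigma>"
    and "X \<in> carrier_mat n p" and "vec_space.rank n X = p"
    and "M = precision_mat \<Sigma> X"
    and "gaussian_density n M f"
    and "i < n" and "j < n" and "i \<noteq> j"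
    and "M $$ (i, j) = 0"
  shows "cond_indep n f i j"
proof -
  have M: "M \<in> carrier_mat n n" "M\<^sup>T = M"
    using precision_mat_symmetric[OF assms(2-5)] assms(6) by (simp_all add: symmetric_mat_def)
  have "M $$ (j, i) = M\<^sup>T $$ (i, j)" using M(1) assms(8,9) by simp
  then have "M $$ (j, i) = 0" using M(2) assms(11) by simp
  then show ?thesis
    using gaussian_density_cond_indep[OF M(1) assms(7-11)] by blast
qed

end
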